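(* Suppose $q$ is real with $0<q<1$, $a\in\mathbb{R}$, and $\lambda<0$. Let $\{Q_k(x)\}$ be the polynomials defined by $Q_0(x)=1$, $Q_1(x)=x+a$ and $$Q_{k+1}(x)=(x+aq^k)Q_k(x)+\lambda q^kQ_{k-1}(x),\qquad k>0,$$ and let $\mu$ be their orthogonality measure, i.e. the (purely discrete) positive measure with $$\int_{-\infty}^{\infty} Q_n(x)Q_m(x)\,d\mu=(-\lambda)^nq^{\binom{n+1}{2}}\delta_{mn}.$$ Then the Stieltjes transform of $\mu$ is given by $$\int_{-\infty}^{\infty}\frac{d\mu(t)}{x-t}=\frac{1}{(x+a)}\;\frac{{}_0\phi_1\!\left[\begin{matrix}-\\ -aq/x\end{matrix};q,\dfrac{\lambda q^2}{x^2}\right]}{{}_0\phi_1\!\left[\begin{matrix}-\\ -a/x\end{matrix};q,\dfrac{\lambda q}{x^2}\right]},$$ for $x\notin\operatorname{supp}(\mu)$.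
   Context: The $q$-rising factorials are $(a;q)_0=1$, $(a;q)_n=(1-a)(1-aq)\cdots(1-aq^{n-1})$ for $n\ge1$. The basic hypergeometric series used here is $${}_0\phi_1\!\left[\begin{matrix}-\\ b_1\end{matrix};q,z\right]=\sum_{k=0}^\infty\frac{q^{k(k-1)}z^k}{(q;q)_k(b_1;q)_k}.$$ Since the recurrence coefficients are bounded, the orthogonality measure $\mu$ has bounded support and is unique. *)

theory Defs
  imports "HOL-Analysis.Analysis" "HOL-Computational_Algebra.Polynomial"
begin

definition q_rising :: "complex \<Rightarrow> complex \<Rightarrow> nat \<Rightarrow> complex" where
  "q_rising a q n = (\<Prod>i<n. 1 - a * q ^ i)"

definition phi01 :: "complex \<Rightarrow> complex \<Rightarrow> complex \<Rightarrow> complex" where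
  "phi01 b q z = (\<Sum>k. q ^ (k * (k - 1)) * z ^ k / (q_rising q q k * q_rising b q k))"

fun Q :: "real \<Rightarrow> real \<Rightarrow> real \<Rightarrow> nat \<Rightarrow> real poly" where
  "Q q a l 0 = 1"
| "Q q a l (Suc 0) = [:a, 1:]"
| "Q q a l (Suc (Suc k)) =
     [:a * q ^ Suc k, 1:] * Q q a l (Suc k) + smult (l * q ^ Suc k) (Q q a l k)"

text \<open>Positivity of the measure is part of the type \<^typ>\<open>real measure\<close>. The predicate
  \<^const>\<open>has_bochner_integral\<close> includes integrability of the product; the case
  \<open>m = n = 0\<close> says that the total mass is 1. Discreteness and boundedness of the support are
  consequences and are not imposed.\<close>

definition orthogonality_measure :: "real \<Rightarrow> real \<Rightarrow> real \<Rightarrow> real measure \<Rightarrow> bool" where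
  "orthogonality_measure q a l \<mu> \<longleftrightarrow>
     sets \<mu> = sets borel \<and>
     (\<forall>n m. has_bochner_integral \<mu> (\<lambda>x. poly (Q q a l n) x * poly (Q q a l m) x)
        (if m = n then (- l) ^ n * q ^ ((n + 1) choose 2) else 0))"

definition supp :: "real measure \<Rightarrow> real set" where
  "supp \<mu> = {x. \<forall>U. open U \<longrightarrow> x \<in> U \<longrightarrow> emeasure \<mu> U > 0}"

definition stieltjes_transform :: "real measure \<Rightarrow> complex \<Rightarrow> complex" where
  "stieltjes_transform \<mu> x = (LINT t|\<mu>. 1 / (x - complex_of_real t))"

text \<open>The right-hand side of the transform formula. Its prefactor or one of its series has a
  vanishing denominator exactly when \<open>x = 0\<close> or \<open>x = - a * q ^ k\<close> for some \<open>k\<close>; at such points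
  the value below is an artefact of division by zero.\<close>

definition phi_ratio :: "real \<Rightarrow> real \<Rightarrow> real \<Rightarrow> complex \<Rightarrow> complex" where
  "phi_ratio q a l x =
     1 / (x + of_real a) *
     (phi01 (- of_real a * of_real q / x) (of_real q) (of_real l * of_real q ^ 2 / x ^ 2) /
      phi01 (- of_real a / x) (of_real q) (of_real l * of_real q / x ^ 2))"

end

theory Submission
  imports Defs
begin

text \<open>
  The formula comes from pairing two solutions of adjoint three-term recurrences. Let
  \<open>s\<^sub>n = \<integral> Q\<^sub>n(t) / (x - t) d\<mu>(t)\<close> be the functions of the second kind, so that \<open>s\<^sub>0\<close> is the Stieltjes
  transform. Orthogonality of \<open>Q\<^sub>n\<close> to constants gives them the recurrence of the
  polynomials, with a source term at the start:
  \<open>s\<^sub>1 = (x + a) s\<^sub>0 - 1\<close> and \<open>s\<^sub>n\<^sub>+\<^sub>1 = (x + a q^n) s\<^sub>n + l q^n s\<^sub>n\<^sub>-\<^sub>1\<close> (\<open>second_kind_Suc\<close>).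
  On the other side, a contiguous relation for the series (\<open>phi01_contiguous\<close>) says that
  \<open>G\<^sub>n = phi01 (- a q^n / x) q (l q^(n+1) / x^2) / ((x + a) \<dots> (x + a q^(n-1)))\<close>
  solves \<open>G\<^sub>n = (x + a q^n) G\<^sub>n\<^sub>+\<^sub>1 + l q^(n+1) G\<^sub>n\<^sub>+\<^sub>2\<close> (\<open>dual_solution_recurrence\<close>).
  The two recurrences make \<open>T\<^sub>n = s\<^sub>n G\<^sub>n + l q^n s\<^sub>n\<^sub>-\<^sub>1 G\<^sub>n\<^sub>+\<^sub>1\<close> independent of \<open>n \<ge> 1\<close>, and
  \<open>T\<^sub>1 = s\<^sub>0 G\<^sub>0 - G\<^sub>1\<close>.

  The constant is zero. Off the support, \<open>s\<^sub>n\<close> is at most a multiple of the \<open>L\<^sup>2\<close> norm of \<open>Q\<^sub>n\<close>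
  (\<open>norm_second_kind_le\<close>), which decays like a Gaussian in \<open>n\<close>, while \<open>G\<^sub>n\<close> grows at most
  geometrically, because the series in it tends to 1 (\<open>phi01_tendsto_1\<close>). Hence
  \<open>s\<^sub>0 G\<^sub>0 = G\<^sub>1\<close>, and here \<open>G\<^sub>0\<close> cannot vanish: otherwise \<open>G\<^sub>1\<close> vanishes too, so by the
  recurrence every \<open>G\<^sub>n\<close> does, against the limit 1. The quotient \<open>G\<^sub>1 / G\<^sub>0\<close> is the right-hand
  side.

  This argument needs \<open>x \<noteq> 0\<close>, which holds because 0 lies in the support (\<open>zero_in_supp\<close>). At a point
  \<open>- a q^k\<close> outside the support the formula is recovered as a limit: these points accumulate
  only at 0, so it holds on a punctured neighbourhood, and the transform is continuous there
  (\<open>isCont_stieltjes_transform\<close>).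
\<close>

section \<open>The series and its contiguous relation\<close>

text \<open>Besides convergence of the series, this is how sequences that decay like a Gaussian are
  shown to be null: they are even summable.\<close>

lemma summable_if_ratio_tendsto_0:
  fixes u :: "nat \<Rightarrow> 'b::{real_normed_div_algebra, banach}"
  assumes "\<And>n. u (Suc n) = c n * u n" and "c \<longlonglongrightarrow> 0"
  shows "summable u"
proof -
  have "eventually (\<lambda>n. norm (c n) < 1/2) sequentially"
    using tendsto_norm[OF assms(2)] by (intro order_tendstoD(2)) auto
  then obtain N where N: "\<And>n. n \<ge> N \<Longrightarrow> norm (c n) < 1/2"
    by (auto simp: eventually_at_top_linorder)
  show ?thesis
  proof (rule summable_ratio_test[where c = "1/2" and N = N])
    fix n assume "n \<ge> N"
    then show "norm (u (Suc n)) \<le> 1/2 * norm (u n)"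
      unfolding assms(1) norm_mult using N[of n] by (intro mult_right_mono) auto
  qed simp
qed

lemma q_rising_0 [simp]: "q_rising b q 0 = 1"
  by (simp add: q_rising_def)

lemma q_rising_Suc: "q_rising b q (Suc n) = q_rising b q n * (1 - b * q ^ n)"
  by (simp add: q_rising_def)

lemma q_rising_Suc_shift: "q_rising b q (Suc n) = (1 - b) * q_rising (b * q) q n"
  unfolding q_rising_def by (subst prod.lessThan_Suc_shift) (simp add: mult.assoc)

lemma q_rising_eq_0_iff: "q_rising b q n = 0 \<longleftrightarrow> (\<exists>i<n. b * q ^ i = 1)"
  by (auto simp: q_rising_def)

lemma q_rising_self_nonzero:
  assumes "norm q < 1"
  shows "q_rising q q n \<noteq> 0"
proof -
  have "q * q ^ i \<noteq> 1" for i
  proof -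
    have "norm (q * q ^ i) < 1"
      using power_Suc_less_one[of "norm q" i] assms
      by (cases "q = 0") (auto simp: norm_mult norm_power)
    then show ?thesis by auto
  qed
  then show ?thesis by (simp add: q_rising_eq_0_iff)
qed

lemma summable_phi01:
  assumes "norm q < 1" and "\<And>i. b * q ^ i \<noteq> 1"
  shows "summable (\<lambda>k. q ^ (k * (k - 1)) * z ^ k / (q_rising q q k * q_rising b q k))"
proof (rule summable_if_ratio_tendsto_0)
  fix k :: nat
  have e: "Suc k * (Suc k - 1) = k * (k - 1) + k + k"
    by (cases k) auto
  show "q ^ (Suc k * (Suc k - 1)) * z ^ Suc k / (q_rising q q (Suc k) * q_rising b q (Suc k))
      = (q ^ k * q ^ k * z / ((1 - q * q ^ k) * (1 - b * q ^ k)))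
        * (q ^ (k * (k - 1)) * z ^ k / (q_rising q q k * q_rising b q k))"
    unfolding e by (simp add: q_rising_Suc power_add mult_ac del: mult_Suc)
next
  have "(\<lambda>k. q ^ k) \<longlonglongrightarrow> 0"
    using assms(1) by (rule LIMSEQ_power_zero)
  then have "(\<lambda>k. q ^ k * q ^ k * z / ((1 - q * q ^ k) * (1 - b * q ^ k)))
      \<longlonglongrightarrow> 0 * 0 * z / ((1 - q * 0) * (1 - b * 0))"
    using assms(1) by (intro tendsto_intros) auto
  then show "(\<lambda>k. q ^ k * q ^ k * z / ((1 - q * q ^ k) * (1 - b * q ^ k))) \<longlonglongrightarrow> 0"
    by simp
qed

text \<open>Compare coefficients. With \<open>(b)\<^sub>k\<close> for the rising factorial,
  \<open>1 / (b)\<^sub>k - q^k / (b q)\<^sub>k = (1 - q^k) / (b)\<^sub>k\<^sub>+\<^sub>1\<close>; the factor \<open>1 - q^k\<close> kills the term \<open>k = 0\<close> and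
  cancels against \<open>(q)\<^sub>k\<close>, so the difference is again such a series, shifted by one index.\<close>

lemma phi01_contiguous:
  assumes q: "norm q < 1" and b: "\<And>i. b * q ^ i \<noteq> 1"
  shows "phi01 b q z - phi01 (b * q) q (z * q)
    = z / ((1 - b) * (1 - b * q)) * phi01 (b * q ^ 2) q (z * q ^ 2)"
proof -
  define t where "t b z k = q ^ (k * (k - 1)) * z ^ k / (q_rising q q k * q_rising b q k)" for b z k
  have phi: "phi01 b q z = (\<Sum>k. t b z k)" for b z
    by (simp add: phi01_def t_def)
  have b': "b * q * q ^ i \<noteq> 1" "b * q ^ 2 * q ^ i \<noteq> 1" for i
    using b[of "Suc i"] b[of "Suc (Suc i)"] by (simp_all add: mult_ac power2_eq_square)
  have s: "summable (t b z)" "summable (t (b * q) (z * q))" "summable (t (b * q ^ 2) (z * q ^ 2))"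
    unfolding t_def by (intro summable_phi01 q b b')+
  have step: "t b z (Suc j) - t (b * q) (z * q) (Suc j)
      = z / ((1 - b) * (1 - b * q)) * t (b * q ^ 2) (z * q ^ 2) j" for j
  proof -
    define R where "R = q_rising (b * q ^ 2) q j"
    define S where "S = q_rising q q j"
    define A where "A = q ^ (j * (j - 1))"
    define p where "p = q ^ Suc j"
    have nz: "1 - b \<noteq> 0" "1 - b * q \<noteq> 0" "1 - b * p \<noteq> 0" "R \<noteq> 0" "S \<noteq> 0" "1 - p \<noteq> 0"
      using b[of 0] b[of 1] b[of "Suc j"] b' q_rising_self_nonzero[OF q, of "Suc j"]
        q_rising_self_nonzero[OF q, of j]
      by (auto simp: R_def S_def p_def q_rising_eq_0_iff q_rising_Suc)
    have r2: "q_rising (b * q) q (Suc j) = (1 - b * q) * R"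
      by (simp add: q_rising_Suc_shift R_def power2_eq_square mult_ac)
    have "q_rising b q (Suc j) * (1 - b * p) = (1 - b) * ((1 - b * q) * R)"
      using q_rising_Suc[of b q "Suc j"] q_rising_Suc_shift[of b q "Suc j"] r2 by (simp add: p_def)
    then have r1: "q_rising b q (Suc j) = (1 - b) * (1 - b * q) * R / (1 - b * p)"
      using nz by (simp add: field_simps)
    have r0: "q_rising q q (Suc j) = S * (1 - p)"
      by (simp add: S_def p_def q_rising_Suc)
    have e: "q ^ (Suc j * (Suc j - 1)) = A * q ^ j * q ^ j"
    proof -
      have "Suc j * (Suc j - 1) = j * (j - 1) + j + j"
        by (cases j) auto
      then show ?thesis by (simp add: A_def power_add del: mult_Suc)
    qed
    have zz: "(z * q) ^ Suc j = z * z ^ j * p" "(z * q ^ 2) ^ j = z ^ j * q ^ j * q ^ j"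
      by (simp_all add: p_def power_mult_distrib power2_eq_square)
    define B where "B = A * q ^ j * q ^ j * (z * z ^ j)"
    have "t b z (Suc j) = B * (1 - b * p) / (S * (1 - p) * ((1 - b) * (1 - b * q) * R))"
      unfolding t_def r1 r0 e B_def using nz by simp
    moreover have "t (b * q) (z * q) (Suc j)
        = B * p * (1 - b) / (S * (1 - p) * ((1 - b) * (1 - b * q) * R))"
      unfolding t_def r2 r0 e zz B_def using nz by (simp add: mult_ac)
    ultimately have "t b z (Suc j) - t (b * q) (z * q) (Suc j)
        = B * (1 - p) / (S * (1 - p) * ((1 - b) * (1 - b * q) * R))"
      by (simp add: diff_divide_distrib[symmetric] algebra_simps)
    also have "\<dots> = B / (S * ((1 - b) * (1 - b * q) * R))"
      using nz by simp
    also have "\<dots> = z / ((1 - b) * (1 - b * q)) * t (b * q ^ 2) (z * q ^ 2) j"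
      unfolding t_def zz B_def by (simp add: A_def R_def S_def mult_ac)
    finally show ?thesis .
  qed
  have "phi01 b q z - phi01 (b * q) q (z * q) = (\<Sum>k. t b z k - t (b * q) (z * q) k)"
    unfolding phi using s by (intro suminf_diff)
  also have "\<dots> = (\<Sum>j. t b z (Suc j) - t (b * q) (z * q) (Suc j))"
    using suminf_split_head[OF summable_diff[OF s(1,2)]] by (simp add: t_def)
  also have "\<dots> = z / ((1 - b) * (1 - b * q)) * phi01 (b * q ^ 2) q (z * q ^ 2)"
    unfolding step phi by (rule suminf_mult[OF s(3)])
  finally show ?thesis .
qed

text \<open>Every term except the constant one tends to 0. Once \<open>b q^n\<close> and \<open>z q^n\<close> are small the
  \<open>k\<close>-th term is at most \<open>(1/2)^k\<close>, uniformly in \<open>n\<close>, so Tannery's theorem applies.\<close>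

lemma phi01_tendsto_1:
  assumes q: "norm q < 1"
  shows "(\<lambda>n. phi01 (b * q ^ n) q (z * q ^ n)) \<longlonglongrightarrow> 1"
proof -
  define t where "t k n = q ^ (k * (k - 1)) * (z * q ^ n) ^ k / (q_rising q q k * q_rising (b * q ^ n) q k)" for k n
  have qn: "(\<lambda>n. q ^ n) \<longlonglongrightarrow> 0"
    using q by (rule LIMSEQ_power_zero)
  have lim: "(t k) \<longlonglongrightarrow> (if k = 0 then 1 else 0)" for k
  proof -
    have "(\<lambda>n. q_rising (b * q ^ n) q k) \<longlonglongrightarrow> (\<Prod>i<k. 1 - b * 0 * q ^ i)"
      unfolding q_rising_def by (intro tendsto_intros qn)
    then have "(t k) \<longlonglongrightarrow> q ^ (k * (k - 1)) * (z * 0) ^ k / (q_rising q q k * (\<Prod>i<k. 1 - b * 0 * q ^ i))"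
      unfolding t_def using q_rising_self_nonzero[OF q] by (intro tendsto_intros qn) auto
    then show ?thesis by (cases k) auto
  qed
  \<comment> \<open>The bounds are chosen so that \<open>((1 - |q|) / 4) / ((1 - |q|) (1/2)) = 1/2\<close>: the two rising
     factorials are bounded below by the powers of \<open>1 - |q|\<close> and of \<open>1/2\<close>.\<close>
  have small: "eventually (\<lambda>n. norm (b * q ^ n) < 1/2) sequentially"
      "eventually (\<lambda>n. norm (z * q ^ n) < (1 - norm q) / 4) sequentially"
    using order_tendstoD(2)[OF tendsto_norm[OF tendsto_mult_left[OF qn, of b]], of "1/2"]
      order_tendstoD(2)[OF tendsto_norm[OF tendsto_mult_left[OF qn, of z]], of "(1 - norm q) / 4"] q
    by simp_all
  have "eventually (\<lambda>n. \<forall>k. norm (t k n) \<le> (1/2) ^ k) sequentially"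
    using small
  proof eventually_elim
    case (elim n)
    show ?case
    proof
      fix k
      have le1: "norm (q ^ i) \<le> 1" for i
        using q by (simp add: norm_power power_le_one)
      have "(1/2) ^ k \<le> norm (q_rising (b * q ^ n) q k)"
      proof -
        have "(\<Prod>i<k. 1/2 :: real) \<le> (\<Prod>i<k. norm (1 - b * q ^ n * q ^ i))"
        proof (intro prod_mono conjI)
          fix i
          have "norm (b * q ^ n * q ^ i) \<le> norm (b * q ^ n) * 1"
            unfolding norm_mult[of "b * q ^ n"] by (intro mult_left_mono le1) auto
          then show "1/2 \<le> norm (1 - b * q ^ n * q ^ i)"
            using elim(1) norm_triangle_ineq2[of 1 "b * q ^ n * q ^ i"] by simp
        qed simp
        then show ?thesis by (simp add: q_rising_def prod_norm)
      qed
      moreover have "(1 - norm q) ^ k \<le> norm (q_rising q q k)"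
      proof -
        have "(\<Prod>i<k. 1 - norm q) \<le> (\<Prod>i<k. norm (1 - q * q ^ i))"
        proof (intro prod_mono conjI)
          fix i
          have "norm (q * q ^ i) \<le> norm q * 1"
            unfolding norm_mult by (intro mult_left_mono le1) auto
          then show "1 - norm q \<le> norm (1 - q * q ^ i)"
            using norm_triangle_ineq2[of 1 "q * q ^ i"] by simp
        qed (use q in simp)
        then show ?thesis by (simp add: q_rising_def prod_norm)
      qed
      ultimately have "(1 - norm q) ^ k * (1/2) ^ k \<le> norm (q_rising q q k * q_rising (b * q ^ n) q k)"
        unfolding norm_mult using q by (intro mult_mono) auto
      moreover have "norm (q ^ (k * (k - 1)) * (z * q ^ n) ^ k) \<le> 1 * ((1 - norm q) / 4) ^ k"
        unfolding norm_mult norm_power[of "z * q ^ n"] using elim(2)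
        by (intro mult_mono le1 power_mono) (auto simp: norm_mult)
      moreover have "0 < (1 - norm q) ^ k * (1/2) ^ k"
        using q by simp
      ultimately have "norm (t k n) \<le> 1 * ((1 - norm q) / 4) ^ k / ((1 - norm q) ^ k * (1/2) ^ k)"
        unfolding t_def norm_divide using q by (intro frac_le) auto
      also have "\<dots> = (1/2) ^ k"
      proof -
        have "(1 - norm q) / 4 / ((1 - norm q) * (1/2)) = 1/2"
          using q by (simp add: field_simps)
        then show ?thesis
          by (metis mult_1 power_divide power_mult_distrib)
      qed
      finally show "norm (t k n) \<le> (1/2) ^ k" .
    qed
  qed
  then have "eventually (\<lambda>(k, n). norm (t k n) \<le> (1/2) ^ k) (at_top \<times>\<^sub>F sequentially)"
    unfolding eventually_prod_filter
    by (intro exI[of _ "\<lambda>_. True"] exI[of _ "\<lambda>n. \<forall>k. norm (t k n) \<le> (1/2) ^ k"]) auto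
  from tannerys_theorem[OF lim this] have "(\<lambda>n. \<Sum>k. t k n) \<longlonglongrightarrow> (\<Sum>k. if k = 0 then 1 else 0)"
    by (simp add: summable_geometric)
  moreover have "(\<Sum>k::nat. if k = 0 then 1 else 0 :: complex) = 1"
    using sums_If_finite_set[of "{0::nat}" "\<lambda>_. 1::complex"] by (simp add: sums_iff)
  ultimately show ?thesis
    by (simp add: phi01_def t_def)
qed

text \<open>A posteriori the \<open>n\<close>-th function of the second kind is the squared norm of \<open>Q\<^sub>n\<close> times the
  ratio of the values of this function at \<open>n + 1\<close> and at 0. Dividing out the squared norm turns
  the recurrence into the adjoint one, which is the form that telescopes. The denominator is the
  rising factorial of \<open>- a / x\<close> times \<open>x^n\<close>.\<close>

definition dual_solution :: "complex \<Rightarrow> complex \<Rightarrow> complex \<Rightarrow> complex \<Rightarrow> nat \<Rightarrow> complex" where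
  "dual_solution q a l x n
    = phi01 (- a * q ^ n / x) q (l * q ^ Suc n / x ^ 2) / (\<Prod>i<n. x + a * q ^ i)"

lemma dual_solution_recurrence:
  assumes q: "norm q < 1" and x: "x \<noteq> 0" "\<And>i. x + a * q ^ i \<noteq> 0"
  shows "dual_solution q a l x n
    = (x + a * q ^ n) * dual_solution q a l x (Suc n)
      + l * q ^ Suc n * dual_solution q a l x (Suc (Suc n))"
proof -
  define b where "b = - a * q ^ n / x"
  define z where "z = l * q ^ Suc n / x ^ 2"
  define P where "P = (\<Prod>i<n. x + a * q ^ i)"
  have nz: "P \<noteq> 0" "x + a * q ^ n \<noteq> 0" "x + a * q ^ Suc n \<noteq> 0"
    using x(2) by (simp_all add: P_def del: power_Suc)
  have d0: "dual_solution q a l x n = phi01 b q z / P"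
    by (simp add: dual_solution_def b_def z_def P_def)
  have "b * q = - a * q ^ Suc n / x" "z * q = l * q ^ Suc (Suc n) / x ^ 2"
      "b * q ^ 2 = - a * q ^ Suc (Suc n) / x" "z * q ^ 2 = l * q ^ Suc (Suc (Suc n)) / x ^ 2"
    by (simp_all add: b_def z_def power2_eq_square)
  then have d1: "dual_solution q a l x (Suc n) = phi01 (b * q) q (z * q) / (P * (x + a * q ^ n))"
    and d2: "dual_solution q a l x (Suc (Suc n))
      = phi01 (b * q ^ 2) q (z * q ^ 2) / (P * (x + a * q ^ n) * (x + a * q ^ Suc n))"
    by (simp_all add: dual_solution_def P_def)
  have "b * q ^ i \<noteq> 1" for i
  proof
    assume "b * q ^ i = 1"
    then have "x + a * q ^ (n + i) = 0"
      using x(1) by (simp add: b_def field_simps power_add add_eq_0_iff2)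
    with x(2) show False by blast
  qed
  then have "phi01 b q z = phi01 (b * q) q (z * q)
      + z / ((1 - b) * (1 - b * q)) * phi01 (b * q ^ 2) q (z * q ^ 2)"
    using phi01_contiguous[OF q, of b z] by (simp add: algebra_simps)
  moreover have "z / ((1 - b) * (1 - b * q)) = l * q ^ Suc n / ((x + a * q ^ n) * (x + a * q ^ Suc n))"
  proof -
    have "1 - b = (x + a * q ^ n) / x" "1 - b * q = (x + a * q ^ Suc n) / x"
      using x(1) by (simp_all add: b_def field_simps)
    then show ?thesis
      using x(1) by (simp add: z_def power2_eq_square)
  qed
  ultimately show ?thesis
    unfolding d0 d1 d2 using nz by (simp add: add_divide_distrib)
qed

section \<open>The support\<close>

text \<open>The complement of the support is a union of null open sets; a countable basis makes the
  union countable.\<close>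

lemma AE_supp:
  assumes "sets \<mu> = sets borel"
  shows "AE t in \<mu>. t \<in> supp \<mu>"
proof -
  obtain B :: "real set set" where B: "countable B" "topological_basis B"
    using ex_countable_basis by auto
  define N where "N = \<Union>{U \<in> B. emeasure \<mu> U = 0}"
  have "(\<Union>U\<in>{U \<in> B. emeasure \<mu> U = 0}. U) \<in> null_sets \<mu>"
  proof (rule null_sets_UN')
    fix U assume "U \<in> {U \<in> B. emeasure \<mu> U = 0}"
    then show "U \<in> null_sets \<mu>"
      using topological_basis_open[OF B(2)] by (auto simp: null_sets_def assms)
  qed (use B(1) in auto)
  then have "N \<in> null_sets \<mu>"
    by (simp add: N_def)
  moreover have "{t \<in> space \<mu>. t \<notin> supp \<mu>} \<subseteq> N"
  proof
    fix t assume "t \<in> {t \<in> space \<mu>. t \<notin> supp \<mu>}"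
    then obtain U where U: "open U" "t \<in> U" "emeasure \<mu> U = 0"
      by (auto simp: supp_def not_less)
    then obtain V where V: "V \<in> B" "t \<in> V" "V \<subseteq> U"
      using topological_basisE[OF B(2)] by metis
    have "emeasure \<mu> V \<le> emeasure \<mu> U"
      using V U by (intro emeasure_mono) (auto simp: assms)
    then show "t \<in> N"
      using U V by (auto simp: N_def)
  qed
  ultimately show ?thesis
    by (rule AE_I')
qed

lemma closed_supp: "closed (supp \<mu>)"
proof -
  have "- supp \<mu> = \<Union>{U. open U \<and> emeasure \<mu> U = 0}"
    by (auto simp: supp_def)
  then show ?thesis
    unfolding closed_def by auto
qed

lemma closed_of_real_supp: "closed (complex_of_real ` supp \<mu>)"
  using closed_supp
  by (intro closed_injective_linear_image) (auto simp: inj_def linear_of_real)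

lemma AE_dist_supp:
  assumes "sets \<mu> = sets borel" and "x \<notin> complex_of_real ` supp \<mu>"
  obtains d where "d > 0" "AE t in \<mu>. d \<le> norm (x - complex_of_real t)"
proof -
  obtain d where d: "d > 0" "\<And>y. y \<in> complex_of_real ` supp \<mu> \<Longrightarrow> d \<le> dist x y"
    using separate_point_closed[OF closed_of_real_supp assms(2)] by auto
  have "AE t in \<mu>. d \<le> norm (x - complex_of_real t)"
    using AE_supp[OF assms(1)] by eventually_elim (auto simp: dist_norm[symmetric] d(2))
  with d(1) that show thesis by blast
qed

section \<open>Functions of the second kind\<close>

definition sqnorm :: "real \<Rightarrow> real \<Rightarrow> nat \<Rightarrow> real" where
  "sqnorm q l n = (- l) ^ n * q ^ ((n + 1) choose 2)"

lemma sqnorm_Suc: "sqnorm q l (Suc n) = - l * q ^ Suc n * sqnorm q l n"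
proof -
  have "(Suc n + 1) choose 2 = ((n + 1) choose 2) + Suc n"
    by (simp add: numeral_2_eq_2)
  then show ?thesis
    by (simp add: sqnorm_def power_add)
qed

lemma sqnorm_pos: "0 < q \<Longrightarrow> l < 0 \<Longrightarrow> 0 < sqnorm q l n"
  by (simp add: sqnorm_def)

lemma orthogonality:
  assumes "orthogonality_measure q a l \<mu>"
  shows "sets \<mu> = sets borel"
    and "has_bochner_integral \<mu> (\<lambda>t. poly (Q q a l n) t * poly (Q q a l m) t)
      (if m = n then sqnorm q l n else 0)"
  using assms unfolding orthogonality_measure_def sqnorm_def by blast+

text \<open>The total mass is the case \<open>n = m = 0\<close> of orthogonality.\<close>

lemma has_bochner_integral_const:
  assumes "orthogonality_measure q a l \<mu>"
  shows "has_bochner_integral \<mu> (\<lambda>_. c :: real) c"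
  using has_bochner_integral_mult_left[OF orthogonality(2)[OF assms, of 0 0], of c]
  by (simp add: sqnorm_def binomial_eq_0)

lemma has_bochner_integral_mono_AE:
  fixes f g :: "'b \<Rightarrow> real"
  assumes "has_bochner_integral M f c" and "has_bochner_integral M g d" and "AE t in M. f t \<le> g t"
  shows "c \<le> d"
  using assms integral_mono_AE[of M f g] by (auto simp: has_bochner_integral_iff)

lemma norm_integral_le:
  fixes f :: "'b \<Rightarrow> 'c::{banach, second_countable_topology}"
  assumes "integrable M f" and "has_bochner_integral M g c" and "AE t in M. norm (f t) \<le> g t"
  shows "norm (integral\<^sup>L M f) \<le> c"
proof -
  have "norm (integral\<^sup>L M f) \<le> (LINT t|M. norm (f t))"
    by (rule integral_norm_bound)
  also have "\<dots> \<le> (LINT t|M. g t)"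
    using assms by (intro integral_mono_AE) (auto simp: has_bochner_integral_iff)
  also have "\<dots> = c"
    using assms(2) by (simp add: has_bochner_integral_iff)
  finally show ?thesis .
qed

definition second_kind :: "real \<Rightarrow> real \<Rightarrow> real \<Rightarrow> real measure \<Rightarrow> complex \<Rightarrow> nat \<Rightarrow> complex" where
  "second_kind q a l \<mu> x n = (LINT t|\<mu>. complex_of_real (poly (Q q a l n) t) / (x - complex_of_real t))"

lemma second_kind_0: "second_kind q a l \<mu> x 0 = stieltjes_transform \<mu> x"
  by (simp add: second_kind_def stieltjes_transform_def)

lemma integral_Q:
  assumes "orthogonality_measure q a l \<mu>"
  shows "has_bochner_integral \<mu> (\<lambda>t. complex_of_real (poly (Q q a l n) t)) (if n = 0 then 1 else 0)"
  using has_bochner_integral_bounded_linear[OF bounded_linear_of_real orthogonality(2)[OF assms, of n 0]]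
  by (auto simp: sqnorm_def binomial_eq_0)

lemma measurable_poly_complex [measurable]:
  "(\<lambda>t. complex_of_real (poly p t)) \<in> borel_measurable borel"
  by (intro borel_measurable_continuous_onI continuous_intros)

lemma norm_divide_far_le:
  fixes w z :: complex
  assumes "0 < d" and "d \<le> norm z"
  shows "norm (w / z) \<le> norm w / d"
  using assms by (auto simp: norm_divide intro!: divide_left_mono mult_pos_pos)

lemma integrable_second_kind:
  assumes "orthogonality_measure q a l \<mu>"
    and "0 < d" and "AE t in \<mu>. d \<le> norm (x - complex_of_real t)"
  shows "integrable \<mu> (\<lambda>t. complex_of_real (poly (Q q a l n) t) / (x - complex_of_real t))"
proof (rule Bochner_Integration.integrable_bound)
  show "integrable \<mu> (\<lambda>t. complex_of_real (poly (Q q a l n) t) / of_real d)"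
    using integral_Q[OF assms(1)] by (auto simp: has_bochner_integral_iff)
  show "(\<lambda>t. complex_of_real (poly (Q q a l n) t) / (x - complex_of_real t)) \<in> borel_measurable \<mu>"
    unfolding measurable_cong_sets[OF orthogonality(1)[OF assms(1)] refl] by measurable
  show "AE t in \<mu>. norm (complex_of_real (poly (Q q a l n) t) / (x - complex_of_real t))
      \<le> norm (complex_of_real (poly (Q q a l n) t) / of_real d)"
    using assms(3)
  proof eventually_elim
    case (elim t)
    from norm_divide_far_le[OF assms(2) this, of "of_real (poly (Q q a l n) t)"] show ?case
      using assms(2) by (simp add: norm_divide)
  qed
qed

text \<open>Cauchy--Schwarz, in the form \<open>|p| \<le> (p^2 / r + r) / 2\<close> with \<open>r\<close> the \<open>L\<^sup>2\<close> norm of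
  \<open>p = Q\<^sub>n\<close>, together with \<open>1 / |x - t| \<le> 1 / d\<close>.\<close>

lemma norm_second_kind_le:
  assumes "0 < q" and "l < 0" and "orthogonality_measure q a l \<mu>"
    and "0 < d" and "AE t in \<mu>. d \<le> norm (x - complex_of_real t)"
  shows "norm (second_kind q a l \<mu> x n) \<le> sqrt (sqnorm q l n) / d"
proof -
  define r where "r = sqrt (sqnorm q l n)"
  have r: "0 < r" "sqnorm q l n = r * r"
    using sqnorm_pos[OF assms(1,2), of n] by (simp_all add: r_def)
  let ?p = "\<lambda>t. poly (Q q a l n) t"
  have "has_bochner_integral \<mu> (\<lambda>t. (?p t * ?p t / r + r) / 2 / d) ((r * r / r + r) / 2 / d)"
    using orthogonality(2)[OF assms(3), of n n] has_bochner_integral_const[OF assms(3), of r]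
    by (intro has_bochner_integral_divide_zero has_bochner_integral_add) (auto simp: r)
  moreover have "AE t in \<mu>. norm (complex_of_real (?p t) / (x - complex_of_real t))
      \<le> (?p t * ?p t / r + r) / 2 / d"
    using assms(5)
  proof eventually_elim
    case (elim t)
    have "0 \<le> (\<bar>?p t\<bar> - r)\<^sup>2"
      by simp
    then have "\<bar>?p t\<bar> \<le> (?p t * ?p t / r + r) / 2"
      using r(1) by (simp add: field_simps power2_eq_square)
    with norm_divide_far_le[OF assms(4) elim, of "of_real (?p t)"] show ?case
      using divide_right_mono[of "\<bar>?p t\<bar>" "(?p t * ?p t / r + r) / 2" d] assms(4) by simp
  qed
  ultimately have "norm (second_kind q a l \<mu> x n) \<le> (r * r / r + r) / 2 / d"
    unfolding second_kind_def by (rule norm_integral_le[OF integrable_second_kind[OF assms(3-5)]])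
  also have "\<dots> = r / d"
    using r(1) by simp
  finally show ?thesis
    by (simp add: r_def)
qed

text \<open>Writing \<open>t + c = (x + c) - (x - t)\<close> in the recurrence of the polynomials leaves the extra
  term \<open>- \<integral> Q\<^sub>n d\<mu>\<close>, which is \<open>-1\<close> for \<open>n = 0\<close> and vanishes otherwise.\<close>

lemma second_kind_Suc:
  assumes "orthogonality_measure q a l \<mu>"
    and "0 < d" and "AE t in \<mu>. d \<le> norm (x - complex_of_real t)"
  shows "second_kind q a l \<mu> x (Suc 0) = (x + a) * second_kind q a l \<mu> x 0 - 1"
    and "second_kind q a l \<mu> x (Suc (Suc n))
      = (x + complex_of_real (a * q ^ Suc n)) * second_kind q a l \<mu> x (Suc n)
        + complex_of_real (l * q ^ Suc n) * second_kind q a l \<mu> x n"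
proof -
  define p where "p n t = complex_of_real (poly (Q q a l n) t)" for n t
  define f where "f n t = p n t / (x - complex_of_real t)" for n t
  have f: "integrable \<mu> (f n)" for n
    unfolding f_def p_def by (rule integrable_second_kind[OF assms])
  have p: "integrable \<mu> (p n)" "integral\<^sup>L \<mu> (p n) = (if n = 0 then 1 else 0)" for n
    using integral_Q[OF assms(1), of n] unfolding p_def has_bochner_integral_iff by blast+
  have s: "second_kind q a l \<mu> x n = integral\<^sup>L \<mu> (f n)" for n
    by (simp add: second_kind_def f_def[abs_def] p_def)
  have "integral\<^sup>L \<mu> (f (Suc 0)) = (LINT t|\<mu>. (x + a) * f 0 t - p 0 t)"
  proof (rule integral_cong_AE)
    show "AE t in \<mu>. f (Suc 0) t = (x + a) * f 0 t - p 0 t"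
      using assms(3)
    proof eventually_elim
      case (elim t)
      then have "x - complex_of_real t \<noteq> 0"
        using assms(2) by auto
      then show ?case
        by (simp add: f_def p_def field_simps)
    qed
  qed (use f p in \<open>auto intro!: borel_measurable_integrable\<close>)
  also have "\<dots> = (x + a) * integral\<^sup>L \<mu> (f 0) - 1"
    using f[of 0] p[of 0] by simp
  finally show "second_kind q a l \<mu> x (Suc 0) = (x + a) * second_kind q a l \<mu> x 0 - 1"
    unfolding s .
  have "integral\<^sup>L \<mu> (f (Suc (Suc n)))
      = (LINT t|\<mu>. (x + a * q ^ Suc n) * f (Suc n) t + l * q ^ Suc n * f n t - p (Suc n) t)"
  proof (rule integral_cong_AE)
    show "AE t in \<mu>. f (Suc (Suc n)) t
        = (x + a * q ^ Suc n) * f (Suc n) t + l * q ^ Suc n * f n t - p (Suc n) t"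
      using assms(3)
    proof eventually_elim
      case (elim t)
      then have "x - complex_of_real t \<noteq> 0"
        using assms(2) by auto
      moreover have "p (Suc (Suc n)) t = (x + a * q ^ Suc n) * p (Suc n) t
          + l * q ^ Suc n * p n t - (x - complex_of_real t) * p (Suc n) t"
        by (simp add: p_def algebra_simps)
      ultimately show ?case
        by (simp add: f_def add_divide_distrib diff_divide_distrib)
    qed
  qed (use f p in \<open>auto intro!: borel_measurable_integrable\<close>)
  also have "\<dots> = (x + a * q ^ Suc n) * integral\<^sup>L \<mu> (f (Suc n)) + l * q ^ Suc n * integral\<^sup>L \<mu> (f n)"
    using f[of n] f[of "Suc n"] p[of "Suc n"] by simp
  finally show "second_kind q a l \<mu> x (Suc (Suc n))
      = (x + a * q ^ Suc n) * second_kind q a l \<mu> x (Suc n)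
        + l * q ^ Suc n * second_kind q a l \<mu> x n"
    unfolding s .
qed


text \<open>If \<open>|t| \<ge> d > 0\<close> almost everywhere, then \<open>\<integral> t^2 Q\<^sub>n^2 d\<mu> \<ge> d^2 \<integral> Q\<^sub>n^2 d\<mu>\<close>. But \<open>t Q\<^sub>n\<close> is a
  combination of \<open>Q\<^sub>n\<^sub>+\<^sub>1\<close>, \<open>Q\<^sub>n\<close> and \<open>Q\<^sub>n\<^sub>-\<^sub>1\<close> whose norm, relative to that of \<open>Q\<^sub>n\<close>, tends to 0,
  since all recurrence coefficients do.\<close>

lemma zero_in_supp:
  assumes q: "0 < q" "q < 1" and l: "l < 0" and \<mu>: "orthogonality_measure q a l \<mu>"
  shows "0 \<in> supp \<mu>"
proof (rule ccontr)
  assume "0 \<notin> supp \<mu>"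
  then have "0 \<notin> complex_of_real ` supp \<mu>"
    by auto
  then obtain d where d: "0 < d" "AE t in \<mu>. d \<le> norm (0 - complex_of_real t)"
    using AE_dist_supp[OF orthogonality(1)[OF \<mu>]] by metis
  \<comment> \<open>The factor 3 comes from \<open>(u - v - w)^2 \<le> 3 (u^2 + v^2 + w^2)\<close>, which bounds
     \<open>t Q\<^sub>n\<^sub>+\<^sub>1\<close> without expanding mixed products.\<close>
  define e where "e n = 3 * (- l * q ^ Suc (Suc n) + (a * q ^ Suc n)\<^sup>2 - l * q ^ Suc n)" for n
  have "d\<^sup>2 \<le> e n" for n
  proof -
    define b c where "b = a * q ^ Suc n" and "c = l * q ^ Suc n"
    define p where "p n t = poly (Q q a l n) t" for n t
    have p: "has_bochner_integral \<mu> (\<lambda>t. p n t * p n t) (sqnorm q l n)" for n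
      using orthogonality(2)[OF \<mu>, of n n] by (simp add: p_def)
    define h where "h = sqnorm q l (Suc n)"
    have h: "0 < h"
      unfolding h_def using q(1) l by (rule sqnorm_pos)
    have ch: "c\<^sup>2 * sqnorm q l n = - c * h"
      by (simp add: h_def sqnorm_Suc c_def power2_eq_square)
    have left: "has_bochner_integral \<mu> (\<lambda>t. d\<^sup>2 * (p (Suc n) t * p (Suc n) t)) (d\<^sup>2 * h)"
      unfolding h_def by (intro has_bochner_integral_mult_right p)
    have right: "has_bochner_integral \<mu>
        (\<lambda>t. 3 * (p (Suc (Suc n)) t * p (Suc (Suc n)) t + b\<^sup>2 * (p (Suc n) t * p (Suc n) t)
          + c\<^sup>2 * (p n t * p n t)))
        (3 * (sqnorm q l (Suc (Suc n)) + b\<^sup>2 * h + c\<^sup>2 * sqnorm q l n))"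
      unfolding h_def by (intro has_bochner_integral_mult_right has_bochner_integral_add p)
    have "d\<^sup>2 * h \<le> 3 * (sqnorm q l (Suc (Suc n)) + b\<^sup>2 * h + c\<^sup>2 * sqnorm q l n)"
    proof (rule has_bochner_integral_mono_AE[OF left right])
      show "AE t in \<mu>. d\<^sup>2 * (p (Suc n) t * p (Suc n) t)
          \<le> 3 * (p (Suc (Suc n)) t * p (Suc (Suc n)) t + b\<^sup>2 * (p (Suc n) t * p (Suc n) t)
            + c\<^sup>2 * (p n t * p n t))"
        using d(2)
      proof eventually_elim
        case (elim t)
        define u v w where "u = p (Suc (Suc n)) t" and "v = b * p (Suc n) t" and "w = c * p n t"
        have "d\<^sup>2 \<le> t\<^sup>2"
          using elim d(1) by (simp add: abs_le_square_iff[symmetric])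
        then have "d\<^sup>2 * (p (Suc n) t * p (Suc n) t) \<le> t\<^sup>2 * (p (Suc n) t * p (Suc n) t)"
          by (intro mult_right_mono) auto
        also have "\<dots> = (u - v - w)\<^sup>2"
        proof -
          have "t * p (Suc n) t = u - v - w"
            by (simp add: u_def v_def w_def p_def b_def c_def algebra_simps)
          then show ?thesis
            by (metis power2_eq_square power_mult_distrib)
        qed
        also have "\<dots> \<le> 3 * (u\<^sup>2 + v\<^sup>2 + w\<^sup>2)"
          using zero_le_power2[of "u + v"] zero_le_power2[of "u + w"] zero_le_power2[of "v - w"]
          by (simp add: power2_eq_square algebra_simps)
        finally show ?case
          by (simp add: u_def v_def w_def power2_eq_square mult_ac)
      qed
    qed
    also have "\<dots> = e n * h"
      unfolding ch by (simp add: e_def sqnorm_Suc[of q l "Suc n"] h_def[symmetric] b_def c_def algebra_simps)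
    finally show ?thesis
      using h by simp
  qed
  moreover have "e \<longlonglongrightarrow> 0"
  proof -
    have qn: "(\<lambda>n. q ^ n) \<longlonglongrightarrow> 0"
      using q by (intro LIMSEQ_power_zero) auto
    have "(\<lambda>n. 3 * (- l * (q * (q * q ^ n)) + (a * (q * q ^ n))\<^sup>2 - l * (q * q ^ n)))
        \<longlonglongrightarrow> 3 * (- l * (q * (q * 0)) + (a * (q * 0))\<^sup>2 - l * (q * 0))"
      by (intro tendsto_intros qn)
    then show ?thesis
      by (simp add: e_def[abs_def])
  qed
  ultimately have "d\<^sup>2 \<le> 0"
    by (intro LIMSEQ_le_const) auto
  with d(1) show False
    by simp
qed

text \<open>For \<open>y\<close> within \<open>d/2\<close> of \<open>x\<close> the integrands differ by
  \<open>|x - y| / (|x - t| |y - t|) \<le> |x - y| / (d (d/2))\<close>, and the measure has mass 1.\<close>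

lemma isCont_stieltjes_transform:
  assumes \<mu>: "orthogonality_measure q a l \<mu>" and x: "x \<notin> complex_of_real ` supp \<mu>"
  shows "isCont (stieltjes_transform \<mu>) x"
proof -
  obtain d where d: "0 < d" "AE t in \<mu>. d \<le> norm (x - complex_of_real t)"
    using AE_dist_supp[OF orthogonality(1)[OF \<mu>] x] by metis
  have S: "integrable \<mu> (\<lambda>t. 1 / (y - complex_of_real t))"
    if "0 < e" "AE t in \<mu>. e \<le> norm (y - complex_of_real t)" for e y
    using integrable_second_kind[OF \<mu> that, of 0] by simp
  have le: "norm (stieltjes_transform \<mu> y - stieltjes_transform \<mu> x) \<le> norm (x - y) / d / (d / 2)"
    if y: "norm (x - y) < d / 2" for y
  proof -
    have d': "0 < d / 2" "AE t in \<mu>. d / 2 \<le> norm (y - complex_of_real t)"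
    proof -
      show "AE t in \<mu>. d / 2 \<le> norm (y - complex_of_real t)"
        using d(2)
      proof eventually_elim
        case (elim t)
        then show ?case
          using y norm_triangle_ineq[of "x - y" "y - complex_of_real t"] by simp
      qed
    qed (use d in simp)
    have "stieltjes_transform \<mu> y - stieltjes_transform \<mu> x
        = (LINT t|\<mu>. 1 / (y - complex_of_real t) - 1 / (x - complex_of_real t))"
      unfolding stieltjes_transform_def
      by (rule Bochner_Integration.integral_diff[symmetric]) (rule S[OF d'] S[OF d])+
    also have "norm \<dots> \<le> norm (x - y) / d / (d / 2)"
    proof (rule norm_integral_le)
      show "AE t in \<mu>. norm (1 / (y - complex_of_real t) - 1 / (x - complex_of_real t))
          \<le> norm (x - y) / d / (d / 2)"
        using d(2) d'(2)
      proof eventually_elim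
        case (elim t)
        have nz: "x - complex_of_real t \<noteq> 0" "y - complex_of_real t \<noteq> 0"
          using elim d(1) by auto
        then have "1 / (y - complex_of_real t) - 1 / (x - complex_of_real t)
            = (x - y) / (x - complex_of_real t) / (y - complex_of_real t)"
          by (simp add: field_simps)
        also have "norm \<dots> \<le> norm ((x - y) / (x - complex_of_real t)) / (d / 2)"
          by (rule norm_divide_far_le[OF d'(1) elim(2)])
        also have "\<dots> \<le> norm (x - y) / d / (d / 2)"
          using norm_divide_far_le[OF d(1) elim(1)] d'(1) by (intro divide_right_mono) auto
        finally show ?case .
      qed
    qed (intro Bochner_Integration.integrable_diff S[OF d'] S[OF d] has_bochner_integral_const[OF \<mu>])+
    finally show ?thesis .
  qed
  have "((\<lambda>y. stieltjes_transform \<mu> y - stieltjes_transform \<mu> x) \<longlongrightarrow> 0) (at x)"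
  proof (rule Lim_null_comparison)
    have "eventually (\<lambda>y. dist y x < d / 2) (at x)"
      using d(1) by (intro order_tendstoD(2)[OF tendsto_dist[OF tendsto_ident_at tendsto_const]]) auto
    then show "eventually (\<lambda>y. norm (stieltjes_transform \<mu> y - stieltjes_transform \<mu> x)
        \<le> norm (x - y) / d / (d / 2)) (at x)"
      by eventually_elim (intro le, simp add: dist_norm norm_minus_commute)
    have "((\<lambda>y. norm (x - y) / d / (d / 2)) \<longlongrightarrow> norm (x - x) / d / (d / 2)) (at x)"
      using d(1) by (intro tendsto_intros) auto
    then show "((\<lambda>y. norm (x - y) / d / (d / 2)) \<longlongrightarrow> 0) (at x)"
      by simp
  qed
  then show ?thesis
    unfolding isCont_def by (rule LIM_zero_cancel)
qed

section \<open>The transform formula\<close>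

lemma phi01_numerator_tendsto_1:
  assumes q: "norm q < 1" and x: "x \<noteq> 0"
  shows "(\<lambda>n. phi01 (- a * q ^ n / x) q (l * q ^ Suc n / x ^ 2)) \<longlonglongrightarrow> 1"
  using phi01_tendsto_1[OF q, of "- a / x" "l * q / x ^ 2"] by (simp add: mult_ac)

lemma stieltjes_transform_eq_phi_ratio:
  assumes q: "0 < q" "q < 1" and l: "l < 0" and \<mu>: "orthogonality_measure q a l \<mu>"
    and x: "x \<notin> complex_of_real ` supp \<mu>" "\<And>k. x \<noteq> - complex_of_real (a * q ^ k)"
  shows "stieltjes_transform \<mu> x = phi_ratio q a l x"
proof -
  obtain d where d: "0 < d" "AE t in \<mu>. d \<le> norm (x - complex_of_real t)"
    using AE_dist_supp[OF orthogonality(1)[OF \<mu>] x(1)] by metis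
  define q' a' l' where "q' = complex_of_real q" and "a' = complex_of_real a" and "l' = complex_of_real l"
  define F where "F n = phi01 (- a' * q' ^ n / x) q' (l' * q' ^ Suc n / x ^ 2)" for n
  define P where "P n = (\<Prod>i<n. x + a' * q' ^ i)" for n
  define G where "G = dual_solution q' a' l' x"
  define s where "s = second_kind q a l \<mu> x"
  have q': "norm q' < 1" "q' \<noteq> 0" "l' \<noteq> 0"
    using q l by (auto simp: q'_def l'_def)
  have x0: "x \<noteq> 0"
    using zero_in_supp[OF q l \<mu>] x(1) by force
  have xa: "x + a' * q' ^ i \<noteq> 0" for i
    using x(2)[of i] by (auto simp: a'_def q'_def add_eq_0_iff2)
  have P: "P n \<noteq> 0" for n
    using xa by (simp add: P_def)
  have G_eq: "G n = F n / P n" for n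
    by (simp add: G_def F_def P_def dual_solution_def)
  have F_lim: "F \<longlonglongrightarrow> 1"
    unfolding F_def using q'(1) x0 by (rule phi01_numerator_tendsto_1)
  have G_rec: "G n = (x + a' * q' ^ n) * G (Suc n) + l' * q' ^ Suc n * G (Suc (Suc n))" for n
    unfolding G_def using q'(1) x0 xa by (rule dual_solution_recurrence)
  have s_rec: "s (Suc 0) = (x + a') * s 0 - 1"
      "s (Suc (Suc n)) = (x + a' * q' ^ Suc n) * s (Suc n) + l' * q' ^ Suc n * s n" for n
    using second_kind_Suc[OF \<mu> d] by (simp_all add: s_def a'_def q'_def l'_def)
  \<comment> \<open>The conserved pairing, indexed from 0 instead of 1.\<close>
  define T where "T n = s (Suc n) * G (Suc n) + l' * q' ^ Suc n * s n * G (Suc (Suc n))" for n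
  have "T (Suc n) = T n" for n
    unfolding T_def s_rec(2) using G_rec[of "Suc n"] by (simp add: algebra_simps)
  then have T_const: "T n = T 0" for n
    by (induction n) auto
  have T_0: "T 0 = s 0 * G 0 - G 1"
    unfolding T_def s_rec(1) using G_rec[of 0] by (simp add: algebra_simps)
  \<comment> \<open>\<open>u\<close> bounds \<open>s n * G n\<close> up to factors with finite limits: the ratio of consecutive norms
     decays like \<open>q^(n/2)\<close>, the factors \<open>x + a' q'^n\<close> tend to \<open>x \<noteq> 0\<close>.\<close>
  define u where "u n = complex_of_real (sqrt (sqnorm q l n)) / P n" for n
  have qn: "(\<lambda>n. q ^ n) \<longlonglongrightarrow> 0" "(\<lambda>n. q' ^ n) \<longlonglongrightarrow> 0"
    using q q'(1) by (auto intro!: LIMSEQ_power_zero)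
  have "u \<longlonglongrightarrow> 0"
  proof (rule summable_LIMSEQ_zero, rule summable_if_ratio_tendsto_0)
    show "u (Suc n) = complex_of_real (sqrt (- l * (q * q ^ n))) / (x + a' * q' ^ n) * u n" for n
    proof -
      have "sqrt (sqnorm q l (Suc n)) = sqrt (- l * (q * q ^ n)) * sqrt (sqnorm q l n)"
        by (simp add: sqnorm_Suc real_sqrt_mult[symmetric])
      then show ?thesis
        by (simp add: u_def P_def mult_ac)
    qed
    have "(\<lambda>n. complex_of_real (sqrt (- l * (q * q ^ n))) / (x + a' * q' ^ n))
        \<longlonglongrightarrow> complex_of_real (sqrt (- l * (q * 0))) / (x + a' * 0)"
      using x0 by (intro tendsto_intros qn) auto
    then show "(\<lambda>n. complex_of_real (sqrt (- l * (q * q ^ n))) / (x + a' * q' ^ n)) \<longlonglongrightarrow> 0"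
      by simp
  qed
  define B where "B n = (norm (u (Suc n) * F (Suc n))
      + norm (l' * (q' * q' ^ n) * u n * F (Suc (Suc n)) / ((x + a' * q' ^ n) * (x + a' * (q' * q' ^ n))))) / d" for n
  have "norm (T 0) \<le> B n" for n
  proof -
    have s_le: "norm (s n) \<le> norm (complex_of_real (sqrt (sqnorm q l n))) / d" for n
      using norm_second_kind_le[OF q(1) l \<mu> d] sqnorm_pos[OF q(1) l, of n] by (simp add: s_def)
    have "norm (T 0) = norm (T n)"
      by (simp add: T_const[of n])
    also have "\<dots> \<le> norm (s (Suc n)) * norm (G (Suc n)) + norm (l' * q' ^ Suc n) * norm (s n) * norm (G (Suc (Suc n)))"
      unfolding T_def norm_mult[symmetric] by (rule norm_triangle_ineq)
    also have "\<dots> \<le> norm (complex_of_real (sqrt (sqnorm q l (Suc n)))) / d * norm (G (Suc n))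
        + norm (l' * q' ^ Suc n) * (norm (complex_of_real (sqrt (sqnorm q l n))) / d) * norm (G (Suc (Suc n)))"
      by (intro add_mono mult_right_mono mult_left_mono s_le) auto
    also have "\<dots> = B n"
      unfolding G_eq B_def u_def
      by (simp add: norm_mult norm_divide norm_power add_divide_distrib P_def mult_ac)
    finally show ?thesis .
  qed
  moreover have "B \<longlonglongrightarrow> (norm (0 * 1 :: complex) + norm (l' * (q' * 0) * 0 * 1 / ((x + a' * 0) * (x + a' * (q' * 0))))) / d"
    unfolding B_def using x0 d(1)
    by (intro tendsto_intros qn \<open>u \<longlonglongrightarrow> 0\<close> LIMSEQ_Suc[OF \<open>u \<longlonglongrightarrow> 0\<close>]
      LIMSEQ_Suc[OF F_lim] LIMSEQ_Suc[OF LIMSEQ_Suc[OF F_lim]]) auto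
  ultimately have "norm (T 0) \<le> 0"
    by (intro LIMSEQ_le_const[of B]) auto
  then have sG: "s 0 * G 0 = G 1"
    using T_0 by simp
  have "G 0 \<noteq> 0"
  proof
    assume "G 0 = 0"
    have "G n = 0 \<and> G (Suc n) = 0" for n
    proof (induction n)
      case 0
      then show ?case using \<open>G 0 = 0\<close> sG by simp
    next
      case (Suc n)
      then have "G n = 0" "G (Suc n) = 0"
        by auto
      then have "l' * q' ^ Suc n * G (Suc (Suc n)) = 0"
        using G_rec[of n] by simp
      then show ?case
        using \<open>G (Suc n) = 0\<close> q'(2,3) by simp
    qed
    then have "F = (\<lambda>_. 0)"
      using G_eq P by (auto simp: fun_eq_iff)
    with F_lim show False
      by (simp add: LIMSEQ_const_iff)
  qed
  then have "s 0 = G 1 / G 0"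
    using sG by (simp add: field_simps)
  then show ?thesis
    by (simp add: s_def second_kind_0 G_eq F_def P_def phi_ratio_def a'_def q'_def l'_def power2_eq_square mult_ac)
qed

theorem mainTheorem6:
  fixes q a l :: real and \<mu> :: "real measure" and x :: complex
  assumes "0 < q" and "q < 1" and "l < 0"
    and "orthogonality_measure q a l \<mu>"
    and "x \<notin> complex_of_real ` supp \<mu>"
  shows "((\<forall>k::nat. x \<noteq> - complex_of_real (a * q ^ k)) \<longrightarrow>
            stieltjes_transform \<mu> x = phi_ratio q a l x) \<and>
         ((\<exists>k::nat. x = - complex_of_real (a * q ^ k)) \<longrightarrow>
            (phi_ratio q a l \<longlongrightarrow> stieltjes_transform \<mu> x) (at x))"
proof (intro conjI impI)
  assume "\<forall>k::nat. x \<noteq> - complex_of_real (a * q ^ k)"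
  then show "stieltjes_transform \<mu> x = phi_ratio q a l x"
    using stieltjes_transform_eq_phi_ratio[OF assms] by blast
next
  have x0: "x \<noteq> 0"
    using zero_in_supp[OF assms(1-4)] assms(5) by force
  have qn: "(\<lambda>k. q ^ k) \<longlonglongrightarrow> 0"
    using assms(1,2) by (intro LIMSEQ_power_zero) simp
  have "(\<lambda>k. norm (complex_of_real (a * q ^ k))) \<longlonglongrightarrow> norm (complex_of_real (a * 0))"
    by (intro tendsto_intros qn)
  then have "eventually (\<lambda>k. norm (complex_of_real (a * q ^ k)) < norm x / 2) sequentially"
    using x0 by (intro order_tendstoD(2)) auto
  then obtain N where N: "\<And>k. k \<ge> N \<Longrightarrow> norm (complex_of_real (a * q ^ k)) < norm x / 2"
    by (auto simp: eventually_at_top_linorder)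
  \<comment> \<open>Near \<open>x\<close> only the finitely many exceptional points with index below \<open>N\<close> have to be
     avoided: the others are closer to 0 than \<open>|x| / 2\<close>.\<close>
  have "eventually (\<lambda>y. \<forall>k\<in>{..<N}. y \<noteq> - complex_of_real (a * q ^ k)) (at x)"
    by (intro eventually_ball_finite ballI eventually_neq_at_within) auto
  moreover have "eventually (\<lambda>y. norm x / 2 < norm y) (at x)"
    using x0 by (intro order_tendstoD(1)[OF tendsto_norm[OF tendsto_ident_at]]) auto
  moreover have "eventually (\<lambda>y. y \<in> - complex_of_real ` supp \<mu>) (at x)"
    using assms(5) closed_of_real_supp by (intro eventually_at_in_open') (auto simp: open_Compl)
  ultimately have "eventually (\<lambda>y. stieltjes_transform \<mu> y = phi_ratio q a l y) (at x)"
  proof eventually_elim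
    case (elim y)
    have "y \<noteq> - complex_of_real (a * q ^ k)" for k
    proof (cases "k < N")
      case True
      with elim(1) show ?thesis by auto
    next
      case False
      with N[of k] elim(2) show ?thesis by auto
    qed
    with elim(3) show ?case
      by (intro stieltjes_transform_eq_phi_ratio[OF assms(1-4)]) auto
  qed
  moreover have "(stieltjes_transform \<mu> \<longlongrightarrow> stieltjes_transform \<mu> x) (at x)"
    using isCont_stieltjes_transform[OF assms(4,5)] by (simp add: isCont_def)
  ultimately show "(phi_ratio q a l \<longlongrightarrow> stieltjes_transform \<mu> x) (at x)"
    by (rule Lim_transform_eventually[rotated])
qed

end
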